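(* For each integer $n\ge 4$ let $\lambda(n,3)=\max\{\rho(G): G\in\mathcal{B}(n,3)\}$ be the maximum spectral radius among all graphs in $\mathcal{B}(n,3)$. Then $$\lim_{n\to\infty} n^{2}\bigl(3-\lambda(n,3)\bigr)=\pi^{2}.$$
   Context: Graphs are finite and simple. The spectral radius $\rho(G)$ of a graph $G$ is the largest eigenvalue of its adjacency matrix. A graph is irregular if its vertices do not all have the same degree. $\mathcal{B}(n,\Delta)$ denotes the set of all connected irregular bipartite graphs on $n$ vertices with maximum degree (exactly) $\Delta$; thus $\mathcal{B}(n,3)$ is the set of all connected irregular bipartite graphs on $n$ vertices with maximum degree three (it is nonempty for every $n\ge 4$). *)

theory Defs
  imports
    Complex_Main
    "Graph_Theory.Digraph_Component"
    "Jordan_Normal_Form.Spectral_Radius"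
begin

text \<open>
  A finite simple graph is a \<^locale>\<open>pair_graph\<close>: a finite vertex set with a symmetric,
  loop-free set of arcs, each edge being represented by its two arcs. The degree of a vertex is
  therefore its \<^const>\<open>out_degree\<close>. A graph on \<open>n\<close> vertices is taken to have vertex set
  \<open>{..<n}\<close>, so that every isomorphism class is represented by its (finitely many) labellings.
\<close>

definition adjacency_matrix :: "nat \<Rightarrow> nat pair_pre_digraph \<Rightarrow> real mat" where
  "adjacency_matrix n G = mat n n (\<lambda>(i, j). if (i, j) \<in> parcs G then 1 else 0)"

text \<open>
  The spectral radius as the largest eigenvalue; for a graph the matrix is real symmetric, so that
  all its eigenvalues are real and belong to this spectrum.
\<close>

definition graph_spectral_radius :: "nat \<Rightarrow> nat pair_pre_digraph \<Rightarrow> real" where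
  "graph_spectral_radius n G = Max (spectrum (adjacency_matrix n G))"

definition bipartite :: "'a pair_pre_digraph \<Rightarrow> bool" where
  "bipartite G \<longleftrightarrow> (\<exists>U V. pverts G = U \<union> V \<and> U \<inter> V = {} \<and>
     (\<forall>(u, v) \<in> parcs G. u \<in> U \<and> v \<in> V \<or> u \<in> V \<and> v \<in> U))"

definition irregular :: "'a pair_pre_digraph \<Rightarrow> bool" where
  "irregular G \<longleftrightarrow> (\<exists>u \<in> pverts G. \<exists>v \<in> pverts G. out_degree G u \<noteq> out_degree G v)"

definition max_degree :: "'a pair_pre_digraph \<Rightarrow> nat" where
  "max_degree G = Max (out_degree G ` pverts G)"

definition connected_irregular_bipartite_graphs :: "nat \<Rightarrow> nat \<Rightarrow> nat pair_pre_digraph set" where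
  "connected_irregular_bipartite_graphs n \<Delta> =
     {G. pair_graph G \<and> pverts G = {..<n} \<and> Digraph_Component.connected G \<and>
         irregular G \<and> bipartite G \<and> max_degree G = \<Delta>}"

definition max_spectral_radius :: "nat \<Rightarrow> nat \<Rightarrow> real" where
  "max_spectral_radius n \<Delta> =
     Max (graph_spectral_radius n ` connected_irregular_bipartite_graphs n \<Delta>)"

end

theory Submission
  imports Defs "HOL-Analysis.Function_Topology" "HOL-Real_Asymp.Real_Asymp"
begin

text \<open>
  Let \<open>x \<ge> 0\<close> be a vector on the vertices of a connected irregular bipartite graph \<open>G\<close> of
  maximum degree 3. Then \<open>3|x|\<^sup>2 - x\<^sup>T A x\<close> is the Dirichlet energy of the graph in which every missing degree is replaced by an edge to an extra
  vertex \<open>0\<close> of value \<open>0\<close>. Sort the vertices by value and write \<open>\<delta>\<^sub>k \<ge> 0\<close> for the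
  consecutive gaps. By bipartiteness and connectedness every cut between consecutive vertices has at
  least two edges (one edge is impossible modulo 3); since a vertex has degree 3, it follows that
  some edge passes over each intermediate vertex. So the energy is at least
  \<open>2 \<Sum> \<delta>\<^sub>k\<^sup>2 + 2 \<Sum> \<delta>\<^sub>k \<delta>\<^sub>k\<^sub>+\<^sub>1\<close>, which is the energy of a path on \<open>n\<close> vertices with
  Dirichlet ends. Hence \<open>\<rho>(G) \<le> 1 + 2 cos (\<pi> / (n + 1))\<close>.

  Conversely, a ladder closed at one end by \<open>K\<^sub>3\<^sub>,\<^sub>3\<close> minus an edge, with a quarter of a sine
  wave as test vector, gives \<open>\<rho>(G) \<ge> 1 + 2 cos (\<pi> / (n - O(1)))\<close>.
\<close>

section \<open>Rayleigh quotients and the spectral radius\<close>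

lemma compact_cube: "compact {x :: nat \<Rightarrow> real. \<forall>i. x i \<in> (if i < n then {-1..1} else {0})}"
proof -
  have "compactin (product_topology (\<lambda>_. euclidean) UNIV)
      (PiE UNIV (\<lambda>i. if i < n then {-1..1::real} else {0}))"
    by (subst compactin_PiE) (auto simp: compactin_euclidean_iff)
  moreover have "PiE UNIV (\<lambda>i. if i < n then {-1..1::real} else {0}) =
      {x. \<forall>i. x i \<in> (if i < n then {-1..1} else {0})}"
    by (auto simp: PiE_def Pi_def)
  ultimately show ?thesis
    by (simp add: euclidean_product_topology compactin_euclidean_iff)
qed

lemma rayleigh_maximizer:
  fixes a :: "nat \<Rightarrow> nat \<Rightarrow> real"
  assumes n: "n > 0" and sym: "\<And>i j. i < n \<Longrightarrow> j < n \<Longrightarrow> a i j = a j i"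
  obtains \<mu> v where "\<exists>i<n. v i \<noteq> 0" "\<And>i. i < n \<Longrightarrow> (\<Sum>j<n. a i j * v j) = \<mu> * v i"
    "\<And>x. (\<Sum>i<n. \<Sum>j<n. a i j * x i * x j) \<le> \<mu> * (\<Sum>i<n. (x i)\<^sup>2)"
proof -
  define q where "q x = (\<Sum>i<n. \<Sum>j<n. a i j * x i * x j)" for x
  define b where "b x y = (\<Sum>i<n. (\<Sum>j<n. a i j * x j) * y i)" for x y
  define s where "s x = (\<Sum>i<n. (x i)\<^sup>2)" for x :: "nat \<Rightarrow> real"
  define C where "C = {x :: nat \<Rightarrow> real. \<forall>i. x i \<in> (if i < n then {-1..1} else {0})}"
  define S where "S = C \<inter> s -` {1}"
  have cont: "continuous_on UNIV (\<lambda>x :: nat \<Rightarrow> real. x i)" for i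
    by (rule continuous_on_product_coordinates)
  have "continuous_on UNIV s" unfolding s_def
    by (intro continuous_intros cont)
  then have "closed (s -` {1})"
    by (simp add: continuous_on_closed_vimage)
  then have "compact S" unfolding S_def C_def using compact_cube by (intro compact_Int_closed)
  moreover have "(\<lambda>i. if i = 0 then 1 else 0) \<in> S"
    using n by (auto simp: S_def C_def s_def sum.remove[of "{..<n}" 0])
  moreover have "continuous_on S q" unfolding q_def
    by (intro continuous_intros continuous_on_subset[OF cont]) auto
  ultimately obtain v where v: "v \<in> S" and vmax: "\<And>y. y \<in> S \<Longrightarrow> q y \<le> q v"
    using continuous_attains_sup[of S q] by blast
  have sv: "s v = 1" using v by (auto simp: S_def)
  have scale: "q (\<lambda>i. c * x i) = c\<^sup>2 * q x" "s (\<lambda>i. c * x i) = c\<^sup>2 * s x" for c x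
    by (simp_all add: q_def s_def sum_distrib_left power2_eq_square algebra_simps)
  have bound: "q x \<le> q v * s x" for x
  proof (cases "s x = 0")
    case True
    then have "\<forall>i<n. x i = 0" by (simp add: s_def sum_nonneg_eq_0_iff)
    then show ?thesis using True by (simp add: q_def)
  next
    case False
    moreover have "s x \<ge> 0" by (simp add: s_def sum_nonneg)
    ultimately have pos: "s x > 0" by simp
    define c where "c = 1 / sqrt (s x)"
    have c2: "c\<^sup>2 = 1 / s x" using pos by (simp add: c_def power_divide)
    define y where "y = (\<lambda>i. if i < n then c * x i else 0)"
    have eq: "q y = q (\<lambda>i. c * x i)" "s y = s (\<lambda>i. c * x i)" by (simp_all add: q_def s_def y_def)
    then have sy: "s y = 1" using pos by (simp add: scale c2)
    have "y i \<in> {-1..1}" if "i < n" for i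
    proof -
      have "(y i)\<^sup>2 \<le> s y" unfolding s_def using that by (intro member_le_sum) auto
      then show ?thesis using sy by (simp add: abs_square_le_1 abs_le_iff)
    qed
    then have "y \<in> S" using sy by (auto simp: S_def C_def y_def)
    then have "q x / s x \<le> q v" using vmax[of y] eq by (simp add: scale c2)
    then show ?thesis using pos by (simp add: divide_simps)
  qed
  have bsym: "b x y = b y x" for x y
  proof -
    have "b x y = (\<Sum>i<n. \<Sum>j<n. a i j * x j * y i)" by (simp add: b_def sum_distrib_right)
    also have "\<dots> = (\<Sum>j<n. \<Sum>i<n. a i j * x j * y i)" by (rule sum.swap)
    also have "\<dots> = (\<Sum>j<n. \<Sum>i<n. a j i * y i * x j)"
      by (intro sum.cong refl) (auto simp: sym)
    finally show ?thesis by (simp add: b_def sum_distrib_right)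
  qed
  have qb: "q x = b x x" for x
    unfolding q_def b_def sum_distrib_right by (intro sum.cong refl) simp
  define w where "w i = (\<Sum>j<n. a i j * v j) - q v * v i" for i
  have ww: "s w = b v w - q v * (\<Sum>i<n. v i * w i)"
    by (simp add: s_def b_def w_def power2_eq_square sum_distrib_left sum_subtractf[symmetric] algebra_simps)
  have "2 * t * s w + t\<^sup>2 * (q w - q v * s w) \<le> 0" for t
  proof -
    let ?y = "\<lambda>i. v i + t * w i"
    have "q ?y = b v v + t * b v w + t * b w v + t\<^sup>2 * b w w"
      unfolding qb by (simp add: b_def sum.distrib sum_distrib_left algebra_simps power2_eq_square)
    then have "q ?y = q v + 2 * t * b v w + t\<^sup>2 * q w" by (simp add: qb bsym[of w v])
    moreover have "s ?y = s v + 2 * t * (\<Sum>i<n. v i * w i) + t\<^sup>2 * s w"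
      by (simp add: s_def power2_eq_square sum.distrib sum_distrib_left algebra_simps)
    ultimately have "q v + 2 * t * b v w + t\<^sup>2 * q w
        \<le> q v * (1 + 2 * t * (\<Sum>i<n. v i * w i) + t\<^sup>2 * s w)"
      using bound[of ?y] sv by simp
    moreover have "b v w = s w + q v * (\<Sum>i<n. v i * w i)" using ww by simp
    ultimately show ?thesis by (simp add: algebra_simps)
  qed
  then have key: "2 * t * s w \<le> t\<^sup>2 * \<bar>q w - q v * s w\<bar>" for t
    by (smt (verit) minus_mult_minus mult_left_mono mult_minus_right zero_le_power2)
  have "s w = 0"
  proof (rule ccontr)
    assume "s w \<noteq> 0"
    moreover have "s w \<ge> 0" by (simp add: s_def sum_nonneg)
    ultimately have pos: "s w > 0" by simp
    let ?k = "\<bar>q w - q v * s w\<bar> + 1"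
    have "2 * (s w / ?k) * s w \<le> (s w / ?k)\<^sup>2 * \<bar>q w - q v * s w\<bar>" by (rule key)
    also have "\<dots> \<le> (s w / ?k)\<^sup>2 * ?k" by (intro mult_left_mono) auto
    also have "\<dots> = (s w / ?k) * s w" by (simp add: power2_eq_square)
    finally show False using pos by (auto simp: divide_simps split: if_splits)
  qed
  then have "\<forall>i<n. w i = 0" by (simp add: s_def sum_nonneg_eq_0_iff)
  moreover have "\<exists>i<n. v i \<noteq> 0" using sv by (auto simp: s_def intro: ccontr)
  ultimately show ?thesis using bound by (intro that[of v "q v"]) (auto simp: w_def q_def s_def)
qed

lemma adjacency_matrix_carrier: "adjacency_matrix n G \<in> carrier_mat n n"
  by (simp add: adjacency_matrix_def)

lemma eigenvalue_adjacency_matrix_iff: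
  "eigenvalue (adjacency_matrix n G) \<mu> \<longleftrightarrow> (\<exists>v. (\<exists>i<n. v i \<noteq> 0) \<and>
     (\<forall>i<n. (\<Sum>j<n. of_bool ((i, j) \<in> parcs G) * v j) = \<mu> * v i))" (is "?L \<longleftrightarrow> ?R")
proof
  assume ?L
  then obtain v where v: "v \<in> carrier_vec n" "v \<noteq> 0\<^sub>v n"
    "adjacency_matrix n G *\<^sub>v v = \<mu> \<cdot>\<^sub>v v"
    by (auto simp: eigenvalue_def eigenvector_def adjacency_matrix_def)
  have "(\<Sum>j<n. of_bool ((i, j) \<in> parcs G) * v $ j) = \<mu> * v $ i" if "i < n" for i
  proof -
    have "(adjacency_matrix n G *\<^sub>v v) $ i = (\<mu> \<cdot>\<^sub>v v) $ i" by (simp add: v(3))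
    then show ?thesis using that v(1)
      by (auto simp: adjacency_matrix_def scalar_prod_def lessThan_atLeast0 of_bool_def)
  qed
  moreover have "\<exists>i<n. v $ i \<noteq> 0" using v(1,2) by (auto intro!: eq_vecI)
  ultimately show ?R by (intro exI[of _ "\<lambda>i. v $ i"]) auto
next
  assume ?R
  then obtain v where v: "\<exists>i<n. v i \<noteq> 0"
    "\<And>i. i < n \<Longrightarrow> (\<Sum>j<n. of_bool ((i, j) \<in> parcs G) * v j) = \<mu> * v i" by blast
  have "adjacency_matrix n G *\<^sub>v vec n v = \<mu> \<cdot>\<^sub>v vec n v"
  proof (rule eq_vecI)
    fix i assume "i < dim_vec (\<mu> \<cdot>\<^sub>v vec n v)"
    then show "(adjacency_matrix n G *\<^sub>v vec n v) $ i = (\<mu> \<cdot>\<^sub>v vec n v) $ i"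
      using v(2)[of i] by (simp add: adjacency_matrix_def scalar_prod_def lessThan_atLeast0 of_bool_def)
  qed (simp add: adjacency_matrix_def)
  moreover have "vec n v \<noteq> 0\<^sub>v n" using v(1) by (auto simp: vec_eq_iff)
  ultimately have "eigenvector (adjacency_matrix n G) (vec n v) \<mu>"
    by (simp add: eigenvector_def adjacency_matrix_def)
  then show ?L by (auto simp: eigenvalue_def)
qed

lemma graph_spectral_radius:
  assumes n: "n > 0" and sym: "\<And>u v. (u, v) \<in> parcs G \<Longrightarrow> (v, u) \<in> parcs G"
  shows eigenvalue_graph_spectral_radius:
      "eigenvalue (adjacency_matrix n G) (graph_spectral_radius n G)"
    and rayleigh_le_graph_spectral_radius:
      "(\<Sum>i<n. \<Sum>j<n. of_bool ((i, j) \<in> parcs G) * x i * x j)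
         \<le> graph_spectral_radius n G * (\<Sum>i<n. (x i)\<^sup>2)"
proof -
  define a where "a i j = (of_bool ((i, j) \<in> parcs G) :: real)" for i j
  obtain \<mu> v where v: "\<exists>i<n. v i \<noteq> 0" "\<And>i. i < n \<Longrightarrow> (\<Sum>j<n. a i j * v j) = \<mu> * v i"
    "\<And>x. (\<Sum>i<n. \<Sum>j<n. a i j * x i * x j) \<le> \<mu> * (\<Sum>i<n. (x i)\<^sup>2)"
    by (rule rayleigh_maximizer[OF n, of a]) (use sym in \<open>auto simp: a_def\<close>)
  have fin: "finite (spectrum (adjacency_matrix n G))"
    by (rule card_finite_spectrum[OF adjacency_matrix_carrier])
  have mu: "\<mu> \<in> spectrum (adjacency_matrix n G)"
    using v unfolding spectrum_def eigenvalue_adjacency_matrix_iff a_def by blast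
  then have "graph_spectral_radius n G \<in> spectrum (adjacency_matrix n G)"
    unfolding graph_spectral_radius_def using fin by (intro Max_in) auto
  then show "eigenvalue (adjacency_matrix n G) (graph_spectral_radius n G)"
    by (simp add: spectrum_def)
  have "\<mu> \<le> graph_spectral_radius n G"
    unfolding graph_spectral_radius_def using fin mu by (intro Max_ge)
  then have "\<mu> * (\<Sum>i<n. (x i)\<^sup>2) \<le> graph_spectral_radius n G * (\<Sum>i<n. (x i)\<^sup>2)"
    by (intro mult_right_mono sum_nonneg) auto
  then show "(\<Sum>i<n. \<Sum>j<n. of_bool ((i, j) \<in> parcs G) * x i * x j)
         \<le> graph_spectral_radius n G * (\<Sum>i<n. (x i)\<^sup>2)"
    using v(3)[of x] by (simp add: a_def)
qed

section \<open>The Dirichlet energy of a sorted vector\<close>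

lemma sq_diff_ge_gaps:
  fixes x :: "nat \<Rightarrow> real"
  assumes mono: "mono x" and "j \<le> n"
  shows "(\<Sum>k<n. of_bool (i \<le> k \<and> k < j) * (x (Suc k) - x k)\<^sup>2) +
      2 * (\<Sum>k<n - 1. of_bool (i \<le> k \<and> Suc k < j) * ((x (Suc k) - x k) * (x (Suc (Suc k)) - x (Suc k))))
      \<le> of_bool (i < j) * (x j - x i)\<^sup>2"
  using \<open>j \<le> n\<close>
proof (induction j)
  case 0
  then show ?case by simp
next
  case (Suc j)
  let ?g = "\<lambda>k. x (Suc k) - x k"
  have g: "?g k \<ge> 0" for k using mono by (simp add: mono_iff_le_Suc)
  show ?case
  proof (cases "i \<le> j")
    case False
    then have "\<not> (i \<le> k \<and> k < Suc j)" "\<not> (i \<le> k \<and> Suc k < Suc j)" for k by auto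
    then show ?thesis using False by (simp only: of_bool_eq mult_zero_left sum.neutral_const) simp
  next
    case True
    have 1: "(\<Sum>k<n. of_bool (i \<le> k \<and> k < Suc j) * (?g k)\<^sup>2) =
        (\<Sum>k<n. of_bool (i \<le> k \<and> k < j) * (?g k)\<^sup>2) + (?g j)\<^sup>2"
    proof -
      have "(\<Sum>k<n. of_bool (i \<le> k \<and> k < Suc j) * (?g k)\<^sup>2) =
        (\<Sum>k<n. of_bool (i \<le> k \<and> k < j) * (?g k)\<^sup>2 + (if k = j then (?g j)\<^sup>2 else 0))"
        using True by (intro sum.cong) (auto simp: less_Suc_eq)
      also have "\<dots> = (\<Sum>k<n. of_bool (i \<le> k \<and> k < j) * (?g k)\<^sup>2) + (?g j)\<^sup>2"
        using Suc.prems by (simp add: sum.distrib sum.delta)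
      finally show ?thesis .
    qed
    show ?thesis
    proof (cases "i = j")
      case True
      have "\<not> (i \<le> k \<and> Suc k < Suc j)" for k using True by auto
      moreover have "\<not> (i \<le> k \<and> k < j)" for k using True by auto
      ultimately show ?thesis unfolding 1 using True
        by (simp only: of_bool_eq mult_zero_left sum.neutral_const) simp
    next
      case False
      then obtain j' where j': "j = Suc j'" "i \<le> j'" using \<open>i \<le> j\<close> by (cases j) auto
      have "(\<Sum>k<n - 1. of_bool (i \<le> k \<and> Suc k < Suc j) * (?g k * ?g (Suc k))) =
        (\<Sum>k<n - 1. of_bool (i \<le> k \<and> Suc k < j) * (?g k * ?g (Suc k))
           + (if k = j' then ?g j' * ?g j else 0))"
        using j' by (intro sum.cong) (auto simp: less_Suc_eq)
      also have "\<dots> = (\<Sum>k<n - 1. of_bool (i \<le> k \<and> Suc k < j) * (?g k * ?g (Suc k))) + ?g j' * ?g j"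
        using Suc.prems j' by (auto simp: sum.distrib sum.delta)
      finally have 2: "(\<Sum>k<n - 1. of_bool (i \<le> k \<and> Suc k < Suc j) * (?g k * ?g (Suc k))) =
        (\<Sum>k<n - 1. of_bool (i \<le> k \<and> Suc k < j) * (?g k * ?g (Suc k))) + ?g j' * ?g j" .
      have "?g j' * ?g j \<le> (x j - x i) * ?g j"
        using monoD[OF mono j'(2)] g[of j] by (intro mult_right_mono) (auto simp: j')
      moreover have "(x (Suc j) - x i)\<^sup>2 = (x j - x i)\<^sup>2 + 2 * ((x j - x i) * ?g j) + (?g j)\<^sup>2"
        by (simp add: power2_eq_square algebra_simps)
      moreover have "j' < n - 1" using Suc.prems j' by simp
      moreover note Suc.IH
      ultimately show ?thesis unfolding 1 2 using Suc.prems \<open>i \<le> j\<close> j'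
        by (simp add: algebra_simps del: sum_of_bool_mult_eq)
    qed
  qed
qed

text \<open>The form on the right is that of a path with Dirichlet ends whose vertices are visited in
  the order \<open>1, 3, 5, \<dots>, 6, 4, 2\<close>; \<open>w\<close> is its positive ground state.\<close>

lemma path_dirichlet_bound:
  fixes x :: "nat \<Rightarrow> real"
  assumes n: "n \<ge> 2" and x0: "x 0 = 0"
  shows "(2 - 2 * cos (pi / (real n + 1))) * (\<Sum>i=1..n. (x i)\<^sup>2)
    \<le> (x 1)\<^sup>2 + (\<Sum>k<n-1. (x (k + 2) - x k)\<^sup>2) + (x n - x (n - 1))\<^sup>2"
proof -
  obtain m where m: "n = Suc (Suc m)" using n by (metis add_2_eq_Suc le_Suc_ex)
  define \<theta> where "\<theta> = pi / (real n + 1)"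
  define s where "s a = sin (\<theta> * a)" for a
  define h where "h k = real ((k + 1) div 2)" for k
  define w where "w k = s (h k)" for k
  have \<theta>: "\<theta> > 0" "\<theta> * (real n + 1) = pi" by (simp_all add: \<theta>_def)
  have wpos: "w k > 0" if "1 \<le> k" "k \<le> n" for k
  proof -
    have "real ((k + 1) div 2) < real n + 1" "real ((k + 1) div 2) > 0" using that by linarith+
    then have "\<theta> * real ((k + 1) div 2) < \<theta> * (real n + 1)" "\<theta> * real ((k + 1) div 2) > 0"
      using \<theta>(1) by (auto intro: mult_strict_left_mono)
    then show ?thesis using \<theta>(2) by (simp add: w_def s_def h_def sin_gt_zero)
  qed
  have reflect: "w k = w l" if "h k = h l \<or> h k = real n + 1 - h l" for k l
    using that
  proof
    assume "h k = real n + 1 - h l"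
    then have "\<theta> * h k = \<theta> * (real n + 1) - \<theta> * h l" by (simp only: right_diff_distrib)
    then have "\<theta> * h k = pi - \<theta> * h l" by (simp only: \<theta>(2))
    then show ?thesis by (simp add: w_def s_def)
  qed (simp add: w_def)
  have half: "h k = (if even k then real k / 2 else (real k + 1) / 2)" for k
    by (auto simp: h_def real_of_nat_div elim!: evenE oddE)
  have w1: "w (n + 1) = w n" by (rule reflect) (auto simp: half)
  have w2: "w (n + 2) = w (n - 1)" using n by (intro reflect) (auto simp: half of_nat_diff field_simps)
  define \<alpha> where "\<alpha> k = 1 - s (h k - 1) / w k" for k
  define \<beta> where "\<beta> k = 1 - s (h k + 1) / w k" for k
  have sum2: "\<alpha> k + \<beta> k = 2 - 2 * cos \<theta>" if "1 \<le> k" "k \<le> n" for k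
  proof -
    have "s (h k - 1) + s (h k + 1) = 2 * cos \<theta> * w k"
      by (simp add: s_def w_def algebra_simps sin_add sin_diff)
    then have "s (h k - 1) / w k + s (h k + 1) / w k = 2 * cos \<theta>"
      using wpos[OF that] by (simp add: add_divide_distrib[symmetric])
    then show ?thesis by (simp add: \<alpha>_def \<beta>_def)
  qed
  have shift: "w (k + 2) = s (h k + 1)" "w k = s (h (k + 2) - 1)" for k
  proof -
    have "h (k + 2) = h k + 1" by (simp add: h_def)
    then show "w (k + 2) = s (h k + 1)" "w k = s (h (k + 2) - 1)" by (simp_all add: w_def)
  qed
  have young: "a\<^sup>2 * (1 - p / q) + b\<^sup>2 * (1 - q / p) \<le> (a - b)\<^sup>2"
    if "p > 0" "q > 0" for a b p q :: real
  proof -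
    have "0 \<le> (a * p - b * q)\<^sup>2 / (p * q)" using that by simp
    also have "\<dots> = a\<^sup>2 * (p / q) + b\<^sup>2 * (q / p) - 2 * a * b"
      using that by (simp add: field_simps power2_eq_square)
    finally show ?thesis by (simp add: algebra_simps power2_eq_square)
  qed
  have step: "(x (k + 2))\<^sup>2 * \<alpha> (k + 2) + (x k)\<^sup>2 * \<beta> k \<le> (x (k + 2) - x k)\<^sup>2"
    if "1 \<le> k" "k \<le> m" for k
    using young[of "w k" "w (k + 2)" "x (k + 2)" "x k"] wpos[of k] wpos[of "k + 2"] that m
    unfolding \<alpha>_def \<beta>_def shift[symmetric] by simp
  have last: "(x n)\<^sup>2 * \<beta> n + (x (n - 1))\<^sup>2 * \<beta> (n - 1) \<le> (x n - x (n - 1))\<^sup>2"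
  proof -
    have "\<beta> n = 1 - w (n - 1) / w n" by (simp only: \<beta>_def w2[symmetric] shift(1))
    moreover have "\<beta> (n - 1) = 1 - w n / w (n - 1)"
      using shift(1)[of "n - 1"] w1 n by (simp add: \<beta>_def)
    ultimately show ?thesis using young[of "w (n - 1)" "w n"] wpos[of n] wpos[of "n - 1"] n by simp
  qed
  have first: "\<alpha> 1 = 1" "\<alpha> 2 = 1" by (simp_all add: \<alpha>_def half s_def)
  have "(2 - 2 * cos \<theta>) * (\<Sum>i=1..n. (x i)\<^sup>2) = (\<Sum>i=1..n. (x i)\<^sup>2 * \<alpha> i) + (\<Sum>i=1..n. (x i)\<^sup>2 * \<beta> i)"
    unfolding sum_distrib_left sum.distrib[symmetric] distrib_left[symmetric]
    by (intro sum.cong refl) (simp add: sum2)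
  also have "(\<Sum>i=1..n. (x i)\<^sup>2 * \<alpha> i) = (x 1)\<^sup>2 + (x 2)\<^sup>2 + (\<Sum>k=1..m. (x (k + 2))\<^sup>2 * \<alpha> (k + 2))"
  proof -
    have "{1..n} = insert 1 (insert 2 {1+2..m+2})" using m by auto
    then have "(\<Sum>i=1..n. (x i)\<^sup>2 * \<alpha> i) = (x 1)\<^sup>2 + (x 2)\<^sup>2 + (\<Sum>i=1+2..m+2. (x i)\<^sup>2 * \<alpha> i)"
      using first by simp
    then show ?thesis by (simp only: sum.shift_bounds_cl_nat_ivl)
  qed
  also have "(\<Sum>i=1..n. (x i)\<^sup>2 * \<beta> i) =
      (\<Sum>k=1..m. (x k)\<^sup>2 * \<beta> k) + ((x n)\<^sup>2 * \<beta> n + (x (n - 1))\<^sup>2 * \<beta> (n - 1))"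
    by (simp add: m)
  also have "(x 1)\<^sup>2 + (x 2)\<^sup>2 + (\<Sum>k=1..m. (x (k + 2))\<^sup>2 * \<alpha> (k + 2)) + \<dots> =
      (x 1)\<^sup>2 + (x 2)\<^sup>2 + (\<Sum>k=1..m. (x (k + 2))\<^sup>2 * \<alpha> (k + 2) + (x k)\<^sup>2 * \<beta> k) +
      ((x n)\<^sup>2 * \<beta> n + (x (n - 1))\<^sup>2 * \<beta> (n - 1))"
    by (simp add: sum.distrib)
  also have "\<dots> \<le> (x 1)\<^sup>2 + (x 2)\<^sup>2 + (\<Sum>k=1..m. (x (k + 2) - x k)\<^sup>2) + (x n - x (n - 1))\<^sup>2"
    by (intro add_mono sum_mono last step order.refl) auto
  also have "\<dots> = (x 1)\<^sup>2 + (\<Sum>k<n-1. (x (k + 2) - x k)\<^sup>2) + (x n - x (n - 1))\<^sup>2"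
  proof -
    have "{..<n-1} = insert 0 {1..m}" using m by auto
    then show ?thesis using x0 by (simp add: numeral_2_eq_2)
  qed
  finally show ?thesis by (simp add: \<theta>_def)
qed

lemma cut_form_bound:
  fixes W :: "nat \<Rightarrow> nat \<Rightarrow> nat" and x :: "nat \<Rightarrow> real"
  assumes n: "n \<ge> 2" and mono: "mono x" and x0: "x 0 = 0"
    and sym: "\<And>i j. W i j = W j i"
    and deg: "\<And>i. 1 \<le> i \<Longrightarrow> i \<le> n \<Longrightarrow> (\<Sum>j\<le>n. W i j) = 3"
    and cut: "\<And>k. k < n \<Longrightarrow> 2 \<le> (\<Sum>i\<le>n. \<Sum>j\<le>n. W i j * of_bool (i \<le> k \<and> k < j))"
  shows "(\<Sum>i=1..n. \<Sum>j=1..n. real (W i j) * x i * x j)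
     \<le> (1 + 2 * cos (pi / (real n + 1))) * (\<Sum>i=1..n. (x i)\<^sup>2)"
proof -
  define g where "g k = x (Suc k) - x k" for k
  define c where "c k = (\<Sum>i\<le>n. \<Sum>j\<le>n. W i j * of_bool (i \<le> k \<and> k < j))" for k
  define p where "p k = (\<Sum>i\<le>n. \<Sum>j\<le>n. W i j * of_bool (i \<le> k \<and> Suc k < j))" for k
  define R where "R i j = (\<Sum>k<n. of_bool (i \<le> k \<and> k < j) * (g k)\<^sup>2)
     + 2 * (\<Sum>k<n - 1. of_bool (i \<le> k \<and> Suc k < j) * (g k * g (Suc k)))" for i j
  have g: "g k \<ge> 0" for k using mono by (simp add: g_def mono_iff_le_Suc)
  have p1: "p k \<ge> 1" if "k < n - 1" for k
  proof -
    let ?S = "\<Sum>i\<le>n. \<Sum>j\<le>n. W i j * of_bool (i \<le> k \<and> j = Suc k)"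
    let ?T = "\<Sum>i\<le>n. \<Sum>j\<le>n. W i j * of_bool (i = Suc k \<and> Suc k < j)"
    have "c k + c (Suc k) = 2 * p k + (?S + ?T)"
      unfolding c_def p_def sum_distrib_left sum.distrib[symmetric]
      by (intro sum.cong refl) auto
    moreover have S: "?S = (\<Sum>i\<le>n. \<Sum>j\<le>n. W i j * of_bool (i = Suc k \<and> j \<le> k))"
      by (rule trans[OF sum.swap]) (intro sum.cong refl, auto simp: sym)
    have "?S + ?T \<le> (\<Sum>i\<le>n. \<Sum>j\<le>n. if i = Suc k then W i j else 0)"
      unfolding S sum.distrib[symmetric] by (intro sum_mono) auto
    moreover have "\<dots> = (\<Sum>i\<le>n. if i = Suc k then \<Sum>j\<le>n. W i j else 0)"
      by (rule sum.cong[OF refl]) simp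
    moreover have "\<dots> = 3" using that deg[of "Suc k"] by simp
    ultimately have "c k + c (Suc k) \<le> 2 * p k + 3" by linarith
    moreover have "c k \<ge> 2" "c (Suc k) \<ge> 2" unfolding c_def using that by (intro cut; simp)+
    ultimately show ?thesis by simp
  qed
  have R: "R i j + R j i \<le> (x i - x j)\<^sup>2" if "i \<le> n" "j \<le> n" for i j
  proof -
    have "R i j + R j i \<le> of_bool (i < j) * (x i - x j)\<^sup>2 + of_bool (j < i) * (x i - x j)\<^sup>2"
      using sq_diff_ge_gaps[OF mono that(1), of j] sq_diff_ge_gaps[OF mono that(2), of i]
      unfolding R_def g_def power2_commute[of "x j"] by linarith
    also have "\<dots> \<le> (x i - x j)\<^sup>2" by simp
    finally show ?thesis .
  qed
  have "(2 - 2 * cos (pi / (real n + 1))) * (\<Sum>i=1..n. (x i)\<^sup>2)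
      \<le> (x 1)\<^sup>2 + (\<Sum>k<n-1. (x (k + 2) - x k)\<^sup>2) + (x n - x (n - 1))\<^sup>2"
    using n x0 by (rule path_dirichlet_bound)
  also have "\<dots> = (g 0)\<^sup>2 + (\<Sum>k<n-1. (g k + g (Suc k))\<^sup>2) + (g (n - 1))\<^sup>2"
    using n x0 by (simp add: g_def)
  also have "\<dots> = 2 * (\<Sum>k<n. (g k)\<^sup>2) + 2 * (\<Sum>k<n-1. g k * g (Suc k))"
  proof -
    obtain m where m: "n = Suc m" using n by (cases n) auto
    have "(g 0)\<^sup>2 + (\<Sum>k<m. (g (Suc k))\<^sup>2) = (\<Sum>k<m. (g k)\<^sup>2) + (g m)\<^sup>2"
      using sum.lessThan_Suc_shift[of "\<lambda>k. (g k)\<^sup>2" m] by simp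
    moreover have "(\<Sum>k<m. (g k + g (Suc k))\<^sup>2) =
        (\<Sum>k<m. (g k)\<^sup>2) + (\<Sum>k<m. (g (Suc k))\<^sup>2) + 2 * (\<Sum>k<m. g k * g (Suc k))"
      by (simp add: power2_sum sum.distrib sum_distrib_left mult.assoc)
    ultimately show ?thesis by (simp add: m)
  qed
  also have "\<dots> \<le> (\<Sum>k<n. real (c k) * (g k)\<^sup>2) + 2 * (\<Sum>k<n-1. real (p k) * (g k * g (Suc k)))"
  proof -
    have "2 * (\<Sum>k<n. (g k)\<^sup>2) \<le> (\<Sum>k<n. real (c k) * (g k)\<^sup>2)"
      unfolding sum_distrib_left
    proof (intro sum_mono mult_right_mono)
      fix k assume "k \<in> {..<n}"
      then have "c k \<ge> 2" unfolding c_def by (intro cut) auto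
      then show "2 \<le> real (c k)" by simp
    qed auto
    moreover have "1 * (g k * g (Suc k)) \<le> real (p k) * (g k * g (Suc k))" if "k < n - 1" for k
      using p1[OF that] g by (intro mult_right_mono) auto
    then have "(\<Sum>k<n-1. g k * g (Suc k)) \<le> (\<Sum>k<n-1. real (p k) * (g k * g (Suc k)))"
      by (intro sum_mono) auto
    ultimately show ?thesis by linarith
  qed
  also have "\<dots> = (\<Sum>i\<le>n. \<Sum>j\<le>n. real (W i j) * R i j)"
  proof -
    have "(\<Sum>k<n. real (c k) * (g k)\<^sup>2) =
        (\<Sum>k<n. \<Sum>i\<le>n. \<Sum>j\<le>n. real (W i j) * (of_bool (i \<le> k \<and> k < j) * (g k)\<^sup>2))"
      by (simp add: c_def sum_distrib_right mult.assoc del: sum_mult_of_bool_eq sum_of_bool_mult_eq)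
    also have "\<dots> = (\<Sum>i\<le>n. \<Sum>k<n. \<Sum>j\<le>n. real (W i j) * (of_bool (i \<le> k \<and> k < j) * (g k)\<^sup>2))"
      by (rule sum.swap)
    also have "\<dots> = (\<Sum>i\<le>n. \<Sum>j\<le>n. \<Sum>k<n. real (W i j) * (of_bool (i \<le> k \<and> k < j) * (g k)\<^sup>2))"
      by (intro sum.cong refl sum.swap)
    finally have 1: "(\<Sum>k<n. real (c k) * (g k)\<^sup>2) = \<dots>" .
    have "(\<Sum>k<n-1. real (p k) * (g k * g (Suc k))) =
        (\<Sum>k<n-1. \<Sum>i\<le>n. \<Sum>j\<le>n. real (W i j) * (of_bool (i \<le> k \<and> Suc k < j) * (g k * g (Suc k))))"
      by (simp add: p_def sum_distrib_right mult.assoc del: sum_mult_of_bool_eq sum_of_bool_mult_eq)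
    also have "\<dots> = (\<Sum>i\<le>n. \<Sum>k<n-1. \<Sum>j\<le>n. real (W i j) * (of_bool (i \<le> k \<and> Suc k < j) * (g k * g (Suc k))))"
      by (rule sum.swap)
    also have "\<dots> = (\<Sum>i\<le>n. \<Sum>j\<le>n. \<Sum>k<n-1. real (W i j) * (of_bool (i \<le> k \<and> Suc k < j) * (g k * g (Suc k))))"
      by (intro sum.cong refl sum.swap)
    finally have 2: "(\<Sum>k<n-1. real (p k) * (g k * g (Suc k))) = \<dots>" .
    show ?thesis unfolding 1 2 R_def
      by (simp add: sum_distrib_left sum.distrib distrib_left mult.left_commute[of 2]
        del: sum_mult_of_bool_eq sum_of_bool_mult_eq)
  qed
  finally have lower: "(2 - 2 * cos (pi / (real n + 1))) * (\<Sum>i=1..n. (x i)\<^sup>2)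
      \<le> (\<Sum>i\<le>n. \<Sum>j\<le>n. real (W i j) * R i j)" .
  have "(\<Sum>i\<le>n. \<Sum>j\<le>n. real (W i j) * R i j) = (\<Sum>j\<le>n. \<Sum>i\<le>n. real (W i j) * R i j)"
    by (rule sum.swap)
  then have "2 * (\<Sum>i\<le>n. \<Sum>j\<le>n. real (W i j) * R i j) = (\<Sum>i\<le>n. \<Sum>j\<le>n. real (W i j) * (R i j + R j i))"
    by (simp add: sum.distrib distrib_left sym)
  also have "\<dots> \<le> (\<Sum>i\<le>n. \<Sum>j\<le>n. real (W i j) * (x i - x j)\<^sup>2)"
    by (intro sum_mono mult_left_mono R) auto
  also have "\<dots> = (\<Sum>i\<le>n. \<Sum>j\<le>n. real (W i j) * (x i)\<^sup>2) + (\<Sum>i\<le>n. \<Sum>j\<le>n. real (W i j) * (x j)\<^sup>2)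
      - 2 * (\<Sum>i\<le>n. \<Sum>j\<le>n. real (W i j) * x i * x j)"
    by (simp add: power2_diff sum.distrib sum_subtractf sum_distrib_left algebra_simps)
  also have "(\<Sum>i\<le>n. \<Sum>j\<le>n. real (W i j) * (x j)\<^sup>2) = (\<Sum>i\<le>n. \<Sum>j\<le>n. real (W i j) * (x i)\<^sup>2)"
    by (subst sum.swap) (simp add: sym)
  also have "(\<Sum>i\<le>n. \<Sum>j\<le>n. real (W i j) * (x i)\<^sup>2) = (\<Sum>i=1..n. 3 * (x i)\<^sup>2)"
  proof -
    have "(\<Sum>i\<le>n. \<Sum>j\<le>n. real (W i j) * (x i)\<^sup>2) = (\<Sum>i\<le>n. real (\<Sum>j\<le>n. W i j) * (x i)\<^sup>2)"
      by (simp add: sum_distrib_right)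
    also have "\<dots> = (\<Sum>i=1..n. real (\<Sum>j\<le>n. W i j) * (x i)\<^sup>2)"
      using x0 by (intro sum.mono_neutral_right) (auto simp: Suc_le_eq)
    also have "\<dots> = (\<Sum>i=1..n. 3 * (x i)\<^sup>2)" using deg by (intro sum.cong) auto
    finally show ?thesis .
  qed
  also have "(\<Sum>i\<le>n. \<Sum>j\<le>n. real (W i j) * x i * x j) = (\<Sum>i=1..n. \<Sum>j=1..n. real (W i j) * x i * x j)"
    using x0 by (intro sum.mono_neutral_cong_right) (auto simp: Suc_le_eq intro!: sum.mono_neutral_right)
  finally show ?thesis using lower by (simp add: sum_distrib_left[symmetric] algebra_simps)
qed

section \<open>The upper bound for the spectral radius\<close>

lemma bipartite_cut_ge_2:
  fixes E :: "'a rel" and D :: "'a \<Rightarrow> nat"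
  assumes fin: "finite V" and V: "V = X \<union> Y" "X \<inter> Y = {}"
    and E: "sym E" "\<And>u v. (u, v) \<in> E \<Longrightarrow> u \<in> X \<and> v \<in> Y \<or> u \<in> Y \<and> v \<in> X"
    and deg: "\<And>v. v \<in> V \<Longrightarrow> (\<Sum>w\<in>V. of_bool ((v, w) \<in> E)) + D v = 3"
    and S: "S \<subseteq> V" "(\<exists>v\<in>S. D v > 0) \<or> (\<exists>u\<in>V - S. \<exists>v\<in>S. (u, v) \<in> E)"
  shows "2 \<le> (\<Sum>u\<in>V - S. \<Sum>v\<in>S. of_bool ((u, v) \<in> E)) + (\<Sum>v\<in>S. D v)"
proof -
  define e :: "'a set \<Rightarrow> 'a set \<Rightarrow> nat" where
    "e P Q = (\<Sum>u\<in>P. \<Sum>v\<in>Q. of_bool ((u, v) \<in> E))" for P Q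
  define A where "A = S \<inter> X"
  define B where "B = S \<inter> Y"
  have finS: "finite S" using S(1) fin by (rule finite_subset)
  have AB: "S = A \<union> B" "A \<inter> B = {}" "finite A" "finite B"
    using S(1) V finS by (auto simp: A_def B_def)
  have e_sym: "e P Q = e Q P" for P Q
    unfolding e_def using E(1) by (subst sum.swap) (auto intro!: sum.cong dest: symD)
  have e_un: "e P (Q \<union> R) = e P Q + e P R" if "finite Q" "finite R" "Q \<inter> R = {}" for P Q R
    using that by (simp add: e_def sum.union_disjoint sum.distrib del: sum_of_bool_eq)
  have e_un': "e (Q \<union> R) P = e Q P + e R P" if "finite Q" "finite R" "Q \<inter> R = {}" for P Q R
    using e_un[OF that, of P] by (simp add: e_sym[of P])
  have indep: "e P P = 0" if "P = A \<or> P = B" for P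
  proof -
    have "(u, v) \<notin> E" if "u \<in> P" "v \<in> P" for u v
      using E(2)[of u v] V(2) that \<open>P = A \<or> P = B\<close> unfolding A_def B_def by blast
    then show ?thesis by (simp add: e_def)
  qed
  have count: "3 * card P = (\<Sum>v\<in>P. D v) + e P S + e P (V - S)" if "P \<subseteq> V" for P
  proof -
    have "3 * card P = (\<Sum>v\<in>P. (\<Sum>w\<in>V. of_bool ((v, w) \<in> E)) + D v)"
      using that by (subst sum.cong[OF refl deg]) auto
    also have "\<dots> = e P V + (\<Sum>v\<in>P. D v)" by (simp add: e_def sum.distrib)
    also have "V = S \<union> (V - S)" using S(1) by blast
    also have "e P (S \<union> (V - S)) = e P S + e P (V - S)" using fin finS by (intro e_un) auto
    finally show ?thesis by simp
  qed
  have cA: "3 * card A = (\<Sum>v\<in>A. D v) + e A B + e A (V - S)"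
    using count[of A] S(1) e_un[OF AB(3,4,2), of A] indep AB by auto
  have cB: "3 * card B = (\<Sum>v\<in>B. D v) + e A B + e B (V - S)"
    using count[of B] S(1) e_un[OF AB(3,4,2), of B] indep AB e_sym[of B A] by auto
  have total: "e (V - S) S + (\<Sum>v\<in>S. D v) =
      ((\<Sum>v\<in>A. D v) + e A (V - S)) + ((\<Sum>v\<in>B. D v) + e B (V - S))"
  proof -
    have "e (V - S) S = e A (V - S) + e B (V - S)"
      unfolding e_sym[of "V - S"] by (subst AB(1)) (rule e_un'[OF AB(3,4,2)])
    moreover have "(\<Sum>v\<in>S. D v) = (\<Sum>v\<in>A. D v) + (\<Sum>v\<in>B. D v)"
      by (subst AB(1)) (rule sum.union_disjoint[OF AB(3,4,2)])
    ultimately show ?thesis by simp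
  qed
  have "e (V - S) S + (\<Sum>v\<in>S. D v) \<noteq> 0"
    using S(2) fin finS by (auto simp: e_def)
  moreover have "e (V - S) S + (\<Sum>v\<in>S. D v) \<noteq> 1"
  proof
    have arith: False if "3 * a = d + m + s" "3 * b = d' + m + s'" "d + s + (d' + s') = 1"
      for a b d d' m s s' :: nat
    proof -
      have "d + s = 0 \<or> d' + s' = 0" using that(3) by linarith
      then have "3 * b = 3 * a + 1 \<or> 3 * a = 3 * b + 1"
      proof
        assume "d + s = 0"
        then have "3 * b = 3 * a + 1" using that by linarith
        then show ?thesis ..
      next
        assume "d' + s' = 0"
        then have "3 * a = 3 * b + 1" using that by linarith
        then show ?thesis ..
      qed
      then show False by presburger
    qed
    assume "e (V - S) S + (\<Sum>v\<in>S. D v) = 1"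
    then show False using arith[OF cA cB] total by simp
  qed
  ultimately have "e (V - S) S + (\<Sum>v\<in>S. D v) \<ge> 2" by linarith
  then show ?thesis by (simp add: e_def)
qed

lemma connected_crossing_edge:
  assumes con: "Digraph_Component.connected (with_proj G)"
    and sym: "sym (parcs G)" and S: "S \<subseteq> pverts G" "S \<noteq> {}" "S \<noteq> pverts G"
  shows "\<exists>u\<in>pverts G - S. \<exists>v\<in>S. (u, v) \<in> parcs G"
proof (rule ccontr)
  assume no: "\<not> ?thesis"
  obtain u v where uv: "u \<in> pverts G - S" "v \<in> S" using S by blast
  have "symcl (parcs G) = parcs G" using sym by (auto simp: symcl_def dest: symD)
  then have "(u, v) \<in> rtrancl_on (pverts G) (parcs G)"
    using con uv S(1) by (auto simp: connected_conv)
  then have "v \<in> pverts G - S"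
    by (induction rule: rtrancl_on_induct) (use uv no in auto)
  then show False using uv by simp
qed

lemma obtain_sorting:
  fixes z :: "nat \<Rightarrow> 'a :: linorder"
  obtains \<sigma> where "bij_betw \<sigma> {1..n} {..<n}"
    "\<And>i j. 1 \<le> i \<Longrightarrow> i \<le> j \<Longrightarrow> j \<le> n \<Longrightarrow> z (\<sigma> i) \<le> z (\<sigma> j)"
proof
  define xs where "xs = sort_key z [0..<n]"
  have xs: "distinct xs" "set xs = {..<n}" "length xs = n" "sorted (map z xs)"
    by (auto simp: xs_def)
  have "bij_betw (\<lambda>i. xs ! i) {..<n} {..<n}"
    using xs by (intro bij_betw_nth) auto
  moreover have "bij_betw (\<lambda>i. i - 1) {1..n} {..<n}"
    by (rule bij_betwI[where g = Suc]) auto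
  ultimately show "bij_betw (\<lambda>i. xs ! (i - 1)) {1..n} {..<n}"
    using bij_betw_trans by (fastforce simp: comp_def)
  show "z (xs ! (i - 1)) \<le> z (xs ! (j - 1))" if "1 \<le> i" "i \<le> j" "j \<le> n" for i j
    using sorted_nth_mono[OF xs(4), of "i - 1" "j - 1"] that xs(3) by simp
qed

lemma out_degree_conv_sum:
  assumes "parcs G \<subseteq> UNIV \<times> V" "finite V"
  shows "out_degree (with_proj G) v = (\<Sum>w\<in>V. of_bool ((v, w) \<in> parcs G))"
proof -
  have "out_arcs (with_proj G) v = Pair v ` (V \<inter> {w. (v, w) \<in> parcs G})"
    using assms by (auto simp: out_arcs_def)
  then show ?thesis using assms(2)
    by (simp add: out_degree_def card_image inj_on_def)
qed

lemma quadratic_form_bound: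
  assumes n: "n \<ge> 2" and G: "G \<in> connected_irregular_bipartite_graphs n 3"
  shows "(\<Sum>u<n. \<Sum>v<n. of_bool ((u, v) \<in> parcs G) * y u * y v)
    \<le> (1 + 2 * cos (pi / (real n + 1))) * (\<Sum>v<n. (y v)\<^sup>2)"
proof -
  let ?V = "{..<n}" and ?E = "parcs G"
  have pg: "pair_graph G" and V: "pverts G = ?V"
    and con: "Digraph_Component.connected (with_proj G)"
    and irr: "irregular G" and bip: "bipartite G" and max: "max_degree G = 3"
    using G by (auto simp: connected_irregular_bipartite_graphs_def)
  interpret pair_graph G by (rule pg)
  have sym: "sym ?E" by (auto intro: symI arcs_symmetric)
  have E: "?E \<subseteq> UNIV \<times> ?V" using in_arcsD2 V by auto
  note od = out_degree_conv_sum[OF E finite_lessThan]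
  have le3: "out_degree G v \<le> 3" if "v < n" for v
    using that unfolding max[symmetric] max_degree_def V by (intro Max_ge) auto
  define D where "D v = 3 - out_degree G v" for v
  have deg: "(\<Sum>w<n. of_bool ((v, w) \<in> ?E)) + D v = 3" if "v < n" for v
    using le3[OF that] unfolding D_def od by simp
  obtain X Y where XY: "?V = X \<union> Y" "X \<inter> Y = {}"
    "\<And>u v. (u, v) \<in> ?E \<Longrightarrow> u \<in> X \<and> v \<in> Y \<or> u \<in> Y \<and> v \<in> X"
    using bip unfolding bipartite_def V by fastforce
  have deficient: "\<exists>v<n. D v > 0"
  proof (rule ccontr)
    assume "\<not> ?thesis"
    then have "out_degree G v = 3" if "v < n" for v using le3[OF that] that by (auto simp: D_def)
    then show False using irr by (auto simp: irregular_def V)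
  qed
  have cutS: "2 \<le> (\<Sum>u\<in>?V - S. \<Sum>v\<in>S. of_bool ((u, v) \<in> ?E)) + (\<Sum>v\<in>S. D v)"
    if S: "S \<subseteq> ?V" "S \<noteq> {}" for S
  proof (rule bipartite_cut_ge_2[OF _ XY(1,2) sym XY(3) _ S(1)])
    show "(\<exists>v\<in>S. D v > 0) \<or> (\<exists>u\<in>?V - S. \<exists>v\<in>S. (u, v) \<in> ?E)"
      using deficient connected_crossing_edge[OF con sym, of S] S V by (cases "S = ?V") auto
  qed (use deg in auto)
  obtain \<sigma> where \<sigma>: "bij_betw \<sigma> {1..n} ?V"
    and sorted: "\<And>i j. 1 \<le> i \<Longrightarrow> i \<le> j \<Longrightarrow> j \<le> n \<Longrightarrow> \<bar>y (\<sigma> i)\<bar> \<le> \<bar>y (\<sigma> j)\<bar>"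
    by (rule obtain_sorting[of n "\<lambda>v. \<bar>y v\<bar>"]) blast
  have \<sigma>V: "\<sigma> i < n" if "1 \<le> i" "i \<le> n" for i
    using bij_betwE[OF \<sigma>] that by auto
  define x where "x i = (if i = 0 then 0 else \<bar>y (\<sigma> (min i n))\<bar>)" for i
  define W where "W i j = (if i = 0 then (if j = 0 then 0 else D (\<sigma> j))
     else if j = 0 then D (\<sigma> i) else of_bool ((\<sigma> i, \<sigma> j) \<in> ?E))" for i j
  have insert0: "{..n} = insert 0 {1..n}" by auto
  have form: "(\<Sum>i=1..n. \<Sum>j=1..n. real (W i j) * x i * x j)
     \<le> (1 + 2 * cos (pi / (real n + 1))) * (\<Sum>i=1..n. (x i)\<^sup>2)"
  proof (rule cut_form_bound[OF n])
    show "mono x" using n by (intro monoI) (auto simp: x_def intro!: sorted)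
    show "x 0 = 0" by (simp add: x_def)
    show "W i j = W j i" for i j using sym by (auto simp: W_def dest: symD)
    show "(\<Sum>j\<le>n. W i j) = 3" if "1 \<le> i" "i \<le> n" for i
    proof -
      have "(\<Sum>j=1..n. of_bool ((\<sigma> i, \<sigma> j) \<in> ?E)) = (\<Sum>w<n. of_bool ((\<sigma> i, w) \<in> ?E) :: nat)"
        by (rule sum.reindex_bij_betw[OF \<sigma>])
      then show ?thesis using deg[OF \<sigma>V[OF that]] that
        unfolding insert0 by (simp add: W_def del: sum_of_bool_eq)
    qed
    show "2 \<le> (\<Sum>i\<le>n. \<Sum>j\<le>n. W i j * of_bool (i \<le> k \<and> k < j))" if k: "k < n" for k
    proof -
      define S where "S = \<sigma> ` {k<..n}"
      have sub: "{k<..n} \<subseteq> {1..n}" "{1..k} \<subseteq> {1..n}" using k by auto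
      have inj: "inj_on \<sigma> {1..n}" using \<sigma> by (simp add: bij_betw_def)
      note inj' = inj_on_subset[OF inj sub(1)] inj_on_subset[OF inj sub(2)]
      have "?V - S = \<sigma> ` ({1..n} - {k<..n})"
        using \<sigma> sub unfolding S_def by (metis bij_betw_def inj_on_image_set_diff Diff_subset)
      also have "{1..n} - {k<..n} = {1..k}" using k by auto
      finally have compl: "?V - S = \<sigma> ` {1..k}" .
      have "S \<subseteq> ?V" "S \<noteq> {}" using \<sigma>V k by (auto simp: S_def)
      then have "2 \<le> (\<Sum>u\<in>?V - S. \<Sum>v\<in>S. of_bool ((u, v) \<in> ?E)) + (\<Sum>v\<in>S. D v)"
        by (rule cutS)
      also have "\<dots> = (\<Sum>i=1..k. \<Sum>j\<in>{k<..n}. of_bool ((\<sigma> i, \<sigma> j) \<in> ?E)) + (\<Sum>j\<in>{k<..n}. D (\<sigma> j))"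
        unfolding compl unfolding S_def
        unfolding sum.reindex[OF inj'(1)] sum.reindex[OF inj'(2)] comp_def ..
      also have "\<dots> = (\<Sum>i\<in>insert 0 {1..k}. \<Sum>j\<in>{k<..n}. W i j)"
        by (simp add: W_def del: sum_of_bool_eq)
      also have "\<dots> = (\<Sum>i\<le>n. \<Sum>j\<le>n. W i j * of_bool (i \<le> k \<and> k < j))"
        using k by (intro sum.mono_neutral_cong_left) (auto intro!: sum.mono_neutral_cong_left)
      finally show ?thesis .
    qed
  qed
  have x: "x i = \<bar>y (\<sigma> i)\<bar>" if "i \<in> {1..n}" for i using that by (auto simp: x_def)
  have "(\<Sum>u<n. \<Sum>v<n. of_bool ((u, v) \<in> ?E) * y u * y v)
      \<le> (\<Sum>u<n. \<Sum>v<n. of_bool ((u, v) \<in> ?E) * \<bar>y u\<bar> * \<bar>y v\<bar>)"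
    by (intro sum_mono) (auto simp: abs_mult[symmetric])
  also have "\<dots> = (\<Sum>i=1..n. \<Sum>v<n. of_bool ((\<sigma> i, v) \<in> ?E) * \<bar>y (\<sigma> i)\<bar> * \<bar>y v\<bar>)"
    by (rule sum.reindex_bij_betw[OF \<sigma>, symmetric])
  also have "\<dots> = (\<Sum>i=1..n. \<Sum>j=1..n. of_bool ((\<sigma> i, \<sigma> j) \<in> ?E) * \<bar>y (\<sigma> i)\<bar> * \<bar>y (\<sigma> j)\<bar>)"
    by (intro sum.cong refl sum.reindex_bij_betw[OF \<sigma>, symmetric])
  also have "\<dots> = (\<Sum>i=1..n. \<Sum>j=1..n. real (W i j) * x i * x j)"
    by (intro sum.cong refl) (auto simp: x W_def)
  also note form
  also have "(\<Sum>i=1..n. (x i)\<^sup>2) = (\<Sum>i=1..n. (y (\<sigma> i))\<^sup>2)"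
    by (intro sum.cong refl) (simp add: x)
  also have "\<dots> = (\<Sum>v<n. (y v)\<^sup>2)" by (rule sum.reindex_bij_betw[OF \<sigma>])
  finally show ?thesis .
qed

lemma parcs_sym:
  assumes "G \<in> connected_irregular_bipartite_graphs n \<Delta>" "(u, v) \<in> parcs G"
  shows "(v, u) \<in> parcs G"
proof -
  interpret pair_graph G using assms by (simp add: connected_irregular_bipartite_graphs_def)
  show ?thesis using assms(2) by (rule arcs_symmetric)
qed

lemma graph_spectral_radius_le:
  assumes n: "n \<ge> 2" and G: "G \<in> connected_irregular_bipartite_graphs n 3"
  shows "graph_spectral_radius n G \<le> 1 + 2 * cos (pi / (real n + 1))"
proof -
  let ?\<mu> = "graph_spectral_radius n G"
  have "eigenvalue (adjacency_matrix n G) ?\<mu>"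
    by (rule eigenvalue_graph_spectral_radius) (use n in simp, rule parcs_sym[OF G])
  then obtain v where v': "(\<exists>i<n. v i \<noteq> 0) \<and>
      (\<forall>i<n. (\<Sum>j<n. of_bool ((i, j) \<in> parcs G) * v j) = ?\<mu> * v i)"
    unfolding eigenvalue_adjacency_matrix_iff by (rule exE)
  note v = conjunct1[OF v'] conjunct2[OF v']
  have "?\<mu> * (\<Sum>i<n. (v i)\<^sup>2) = (\<Sum>i<n. v i * (?\<mu> * v i))"
    unfolding sum_distrib_left by (intro sum.cong refl) (simp add: power2_eq_square)
  also have "\<dots> = (\<Sum>i<n. v i * (\<Sum>j<n. of_bool ((i, j) \<in> parcs G) * v j))"
  proof (intro sum.cong refl)
    fix i assume "i \<in> {..<n}"
    then have "(\<Sum>j<n. of_bool ((i, j) \<in> parcs G) * v j) = ?\<mu> * v i" using v(2) by blast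
    then show "v i * (?\<mu> * v i) = v i * (\<Sum>j<n. of_bool ((i, j) \<in> parcs G) * v j)"
      by (simp only:)
  qed
  also have "\<dots> = (\<Sum>i<n. \<Sum>j<n. of_bool ((i, j) \<in> parcs G) * v i * v j)"
    unfolding sum_distrib_left by (intro sum.cong refl) simp
  also have "\<dots> \<le> (1 + 2 * cos (pi / (real n + 1))) * (\<Sum>i<n. (v i)\<^sup>2)"
    by (rule quadratic_form_bound[OF n G])
  finally have le: "?\<mu> * (\<Sum>i<n. (v i)\<^sup>2) \<le> (1 + 2 * cos (pi / (real n + 1))) * (\<Sum>i<n. (v i)\<^sup>2)" .
  obtain i where "i < n" "v i \<noteq> 0" using v(1) by blast
  then have "(\<Sum>i<n. (v i)\<^sup>2) > 0" by (intro sum_pos2[of _ i]) auto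
  with le show ?thesis by (simp add: mult_le_cancel_right)
qed

section \<open>Capped ladders\<close>

text \<open>
  The layers of the ladder are \<open>{2l, 2l + 1}\<close>. The layers \<open>0, 1, 2\<close> form the cap: a
  \<open>K\<^sub>3\<^sub>,\<^sub>3\<close> with parts \<open>{0, 3, 4}\<close> and \<open>{1, 2, 5}\<close> from which the edge
  between \<open>4\<close> and \<open>5\<close> is deleted. For odd \<open>n\<close> the last vertex is a pendant vertex.
\<close>

definition ladder_arc :: "nat \<Rightarrow> nat \<Rightarrow> bool" where
  "ladder_arc i j \<longleftrightarrow> j = i + 2 \<or> even i \<and> i \<noteq> 4 \<and> j = i + 1 \<or> (i, j) = (0, 5) \<or> (i, j) = (1, 4)"

definition capped_ladder :: "nat \<Rightarrow> nat pair_pre_digraph" where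
  "capped_ladder n = \<lparr>pverts = {..<n},
     parcs = {(i, j). i < n \<and> j < n \<and> (ladder_arc i j \<or> ladder_arc j i)}\<rparr>"

definition ladder_nbrs :: "nat \<Rightarrow> nat set" where
  "ladder_nbrs i =
    (if i = 0 then {1, 2, 5} else if i = 1 then {0, 3, 4} else if i = 2 then {0, 3, 4}
     else if i = 3 then {1, 2, 5} else if i = 4 then {1, 2, 6} else if i = 5 then {0, 3, 7}
     else {i - 2, i + 2, if even i then i + 1 else i - 1})"

lemma ladder_arc_iff_nbrs: "ladder_arc i j \<or> ladder_arc j i \<longleftrightarrow> j \<in> ladder_nbrs i"
proof (cases "i < 6")
  case True
  then consider "i = 0" | "i = 1" | "i = 2" | "i = 3" | "i = 4" | "i = 5" by linarith
  then show ?thesis by cases (auto simp: ladder_arc_def ladder_nbrs_def)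
next
  case False
  then have "ladder_nbrs i = {i - 2, i + 2, if even i then i + 1 else i - 1}"
    by (auto simp: ladder_nbrs_def)
  moreover have "ladder_arc i j \<or> ladder_arc j i \<longleftrightarrow>
      j = i - 2 \<or> j = i + 2 \<or> even i \<and> j = i + 1 \<or> odd i \<and> j = i - 1"
    using False unfolding ladder_arc_def prod.inject by presburger
  ultimately show ?thesis by simp
qed

lemma parcs_capped_ladder:
  "(i, j) \<in> parcs (capped_ladder n) \<longleftrightarrow> i < n \<and> j < n \<and> j \<in> ladder_nbrs i"
  by (simp add: capped_ladder_def ladder_arc_iff_nbrs)

lemma pverts_capped_ladder: "pverts (capped_ladder n) = {..<n}"
  by (simp add: capped_ladder_def)

lemma parcs_capped_ladder_sym:
  "(i, j) \<in> parcs (capped_ladder n) \<Longrightarrow> (j, i) \<in> parcs (capped_ladder n)"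
  by (auto simp: capped_ladder_def)

lemma capped_ladder_pair_graph: "pair_graph (capped_ladder n)"
proof unfold_locales
  show "finite (parcs (capped_ladder n))"
    by (rule finite_subset[of _ "{..<n} \<times> {..<n}"]) (auto simp: capped_ladder_def)
  show "symmetric (with_proj (capped_ladder n))"
    by (auto simp: symmetric_def intro!: symI parcs_capped_ladder_sym)
  have "\<not> ladder_arc i i" for i by (auto simp: ladder_arc_def)
  then show "fst e \<noteq> snd e" if "e \<in> parcs (capped_ladder n)" for e
    using that by (cases e) (auto simp: capped_ladder_def)
qed (auto simp: capped_ladder_def)

lemma capped_ladder_connected:
  assumes "n > 0"
  shows "Digraph_Component.connected (with_proj (capped_ladder n))"
proof -
  let ?R = "rtrancl_on {..<n} (symcl (parcs (capped_ladder n)))"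
  have arc: "(u, v) \<in> ?R" if "ladder_arc u v \<or> ladder_arc v u" "u < n" "v < n" for u v
    using that by (intro rtrancl_on_into_rtrancl_on[OF rtrancl_on_refl])
      (auto simp: capped_ladder_def symcl_def)
  have "(i, 0) \<in> ?R \<and> (0, i) \<in> ?R" if "i < n" for i
    using that
  proof (induction i rule: less_induct)
    case (less i)
    show ?case
    proof (cases "i = 0")
      case True
      then show ?thesis using less.prems by simp
    next
      case False
      define j where "j = (if i = 1 then 0 else i - 2)"
      have j: "j < i" "ladder_arc j i" using False by (auto simp: j_def ladder_arc_def)
      then show ?thesis
        using less arc[of i j] arc[of j i] by (meson less_trans rtrancl_on_trans)
    qed
  qed
  then show ?thesis using assms
    unfolding connected_conv with_proj_simps pverts_capped_ladder
    by (auto intro: rtrancl_on_trans)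
qed

lemma capped_ladder_bipartite: "bipartite (capped_ladder n)"
proof -
  define c where "c i \<longleftrightarrow> even (i + i div 2)" for i :: nat
  have verts: "pverts (capped_ladder n) = {i \<in> {..<n}. c i} \<union> {i \<in> {..<n}. \<not> c i}"
    by (auto simp: pverts_capped_ladder)
  have flip: "c i \<longleftrightarrow> \<not> c j" if arc: "ladder_arc i j" for i j
  proof -
    consider "j = i + 2" | "even i" "j = i + 1" | "i = 0" "j = 5" | "i = 1" "j = 4"
      using arc unfolding ladder_arc_def prod.inject by blast
    then show ?thesis
    proof cases
      case 1
      have "(i + 2) div 2 = i div 2 + 1" by simp
      then show ?thesis unfolding c_def 1 by (simp only: even_add) simp
    next
      case 2
      have "(i + 1) div 2 = i div 2" using 2(1) by simp
      then show ?thesis unfolding c_def 2(2) by (simp only: even_add) simp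
    qed (simp_all add: c_def)
  qed
  have "\<forall>(u, v)\<in>parcs (capped_ladder n).
      u \<in> {i \<in> {..<n}. c i} \<and> v \<in> {i \<in> {..<n}. \<not> c i} \<or>
      u \<in> {i \<in> {..<n}. \<not> c i} \<and> v \<in> {i \<in> {..<n}. c i}"
  proof clarify
    fix u v
    assume "(u, v) \<in> parcs (capped_ladder n)" and
      "\<not> (u \<in> {i \<in> {..<n}. \<not> c i} \<and> v \<in> {i \<in> {..<n}. c i})"
    moreover from this(1) have "u < n" "v < n" "ladder_arc u v \<or> ladder_arc v u"
      by (simp_all add: capped_ladder_def)
    moreover from this(3) have "c u \<noteq> c v" using flip[of u v] flip[of v u] by blast
    ultimately show "u \<in> {i \<in> {..<n}. c i} \<and> v \<in> {i \<in> {..<n}. \<not> c i}" by simp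
  qed
  moreover have "{i \<in> {..<n}. c i} \<inter> {i \<in> {..<n}. \<not> c i} = {}" by auto
  ultimately show ?thesis unfolding bipartite_def using verts by (intro exI conjI)
qed

lemma out_degree_capped_ladder:
  assumes "i < n"
  shows "out_degree (with_proj (capped_ladder n)) i = card ({..<n} \<inter> ladder_nbrs i)"
proof -
  have "out_degree (with_proj (capped_ladder n)) i = (\<Sum>w<n. of_bool ((i, w) \<in> parcs (capped_ladder n)))"
    by (rule out_degree_conv_sum) (auto simp: capped_ladder_def)
  also have "\<dots> = card ({..<n} \<inter> {w. (i, w) \<in> parcs (capped_ladder n)})" by simp
  also have "{..<n} \<inter> {w. (i, w) \<in> parcs (capped_ladder n)} = {..<n} \<inter> ladder_nbrs i"
    using assms by (auto simp: parcs_capped_ladder)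
  finally show ?thesis .
qed

lemma finite_ladder_nbrs: "finite (ladder_nbrs i)"
  by (simp add: ladder_nbrs_def)

lemma ladder_nbrs_ge_6:
  assumes "i \<ge> 6" and p: "p = (if even i then i + 1 else i - 1)"
  shows "ladder_nbrs i = {i - 2, i + 2, p}" "i - 2 \<noteq> i + 2" "i - 2 \<noteq> p" "i + 2 \<noteq> p"
proof -
  have "p = i + 1 \<or> p = i - 1" by (simp add: p)
  then show "i - 2 \<noteq> i + 2" "i - 2 \<noteq> p" "i + 2 \<noteq> p" using assms(1) by linarith+
  show "ladder_nbrs i = {i - 2, i + 2, p}" using assms(1) unfolding ladder_nbrs_def p by simp
qed

lemma card_ladder_nbrs: "card (ladder_nbrs i) = 3"
proof (cases "i < 6")
  case True
  then consider "i = 0" | "i = 1" | "i = 2" | "i = 3" | "i = 4" | "i = 5" by linarith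
  then show ?thesis by cases (simp_all add: ladder_nbrs_def)
next
  case False
  then have "i \<ge> 6" by simp
  note nbrs = ladder_nbrs_ge_6[OF this refl]
  show ?thesis unfolding nbrs(1) using nbrs(2-4) by simp
qed

lemma capped_ladder_mem:
  assumes n: "n \<ge> 8"
  shows "capped_ladder n \<in> connected_irregular_bipartite_graphs n 3"
proof -
  let ?d = "out_degree (with_proj (capped_ladder n))"
  have "{..<n} \<inter> ladder_nbrs 0 = ladder_nbrs 0" using n by (auto simp: ladder_nbrs_def)
  then have d0: "?d 0 = 3" using n by (simp add: out_degree_capped_ladder card_ladder_nbrs)
  have le3: "?d i \<le> 3" if "i < n" for i
    unfolding out_degree_capped_ladder[OF that] card_ladder_nbrs[of i, symmetric]
    by (intro card_mono finite_ladder_nbrs) auto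
  have "{..<n} \<inter> ladder_nbrs (n - 1) \<subseteq> {n - 3, n - 2}"
  proof -
    have "n - 1 \<ge> 6" using n by simp
    from ladder_nbrs_ge_6(1)[OF this refl] show ?thesis using n by auto
  qed
  then have "card ({..<n} \<inter> ladder_nbrs (n - 1)) \<le> card {n - 3, n - 2}"
    by (intro card_mono) auto
  also have "\<dots> \<le> 2" by (simp add: card_insert_if)
  finally have "?d (n - 1) \<le> 2" using n by (simp add: out_degree_capped_ladder)
  then have "irregular (capped_ladder n)" unfolding irregular_def pverts_capped_ladder
    using d0 n by (intro bexI[of _ 0] bexI[of _ "n - 1"]) auto
  moreover have "max_degree (capped_ladder n) = 3"
    unfolding max_degree_def pverts_capped_ladder
    using le3 n d0 by (intro Max_eqI) (auto intro!: image_eqI[of _ _ 0])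
  ultimately show ?thesis
    using n capped_ladder_pair_graph capped_ladder_connected capped_ladder_bipartite
    by (simp add: connected_irregular_bipartite_graphs_def pverts_capped_ladder)
qed

lemma capped_ladder_spectral_radius_ge:
  assumes n: "n \<ge> 8"
  shows "1 + 2 * cos (pi / (2 * real (n div 2 - 2))) \<le> graph_spectral_radius n (capped_ladder n)"
proof -
  let ?E = "parcs (capped_ladder n)"
  define q where "q = n div 2"
  define \<phi> where "\<phi> = pi / (2 * real (q - 2))"
  define f where "f l = sin (\<phi> * real (q - max 2 l))" for l
  define x where "x i = f (i div 2)" for i
  have q: "q \<ge> 4" using n unfolding q_def by linarith
  have \<phi>: "\<phi> > 0" "\<phi> * real (q - 2) = pi / 2"
    using q unfolding \<phi>_def by (simp_all del: of_nat_diff)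
  have f_nonneg: "f l \<ge> 0" for l
  proof -
    have "\<phi> * real (q - max 2 l) \<le> \<phi> * real (q - 2)"
      using \<phi>(1) by (intro mult_left_mono) auto
    then have "\<phi> * real (q - max 2 l) \<le> pi" using \<phi>(2) pi_gt_zero by linarith
    then show ?thesis using \<phi>(1) unfolding f_def by (intro sin_ge_zero) auto
  qed
  have f_max: "f l = sin (pi / 2)" if "l \<le> 2" for l
    unfolding f_def max_absorb1[OF that] \<phi>(2) ..
  have f_cap: "f 0 = 1" "f 1 = 1" "f 2 = 1" using f_max[of 0] f_max[of 1] f_max[of 2] by simp_all
  have f3: "f 3 = cos \<phi>"
  proof -
    have "\<phi> * real (q - 3) = \<phi> * real (q - 2) - \<phi>" using q by (simp add: of_nat_diff algebra_simps)
    then show ?thesis using \<phi>(2) by (simp add: f_def sin_diff)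
  qed
  have f_rec: "f (l - 1) + f (l + 1) = 2 * cos \<phi> * f l" if "3 \<le> l" "l < q" for l
  proof -
    have max: "max 2 l = l" "max 2 (l - 1) = l - 1" "max 2 (l + 1) = l + 1" using that by auto
    moreover have "\<phi> * real (q - (l - 1)) = \<phi> * real (q - l) + \<phi>"
      "\<phi> * real (q - (l + 1)) = \<phi> * real (q - l) - \<phi>"
      using that by (simp_all add: of_nat_diff algebra_simps)
    ultimately show ?thesis unfolding f_def max by (simp only: sin_add sin_diff) simp
  qed
  have f_zero: "f l = 0" if "l \<ge> q" for l using that q by (simp add: f_def)
  have local: "(1 + 2 * cos \<phi>) * x i \<le> (\<Sum>j\<in>ladder_nbrs i. x j)" if "i < n" for i
  proof (cases "i < 6")
    case True
    then consider "i = 0" | "i = 1" | "i = 2" | "i = 3" | "i = 4" | "i = 5" by linarith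
    then show ?thesis
      using cos_le_one[of \<phi>] f_cap f3 by cases (simp_all add: ladder_nbrs_def x_def)
  next
    case False
    define l where "l = i div 2"
    have l: "l \<ge> 3" "(i - 2) div 2 = l - 1" "(i + 2) div 2 = l + 1"
      "(if even i then i + 1 else i - 1) div 2 = l"
    proof -
      show "l \<ge> 3" "(i - 2) div 2 = l - 1" "(i + 2) div 2 = l + 1"
        using False unfolding l_def by linarith+
      have "even i \<Longrightarrow> (i + 1) div 2 = i div 2" "odd i \<Longrightarrow> (i - 1) div 2 = i div 2"
        by presburger+
      then show "(if even i then i + 1 else i - 1) div 2 = l" by (simp add: l_def)
    qed
    define p where "p = (if even i then i + 1 else i - 1)"
    have "i \<ge> 6" using False by simp
    note nbrs = ladder_nbrs_ge_6[OF this p_def]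
    then have "(\<Sum>j\<in>ladder_nbrs i. x j) =
        x (i - 2) + x (i + 2) + x (if even i then i + 1 else i - 1)"
      by (simp add: p_def[symmetric] del: One_nat_def)
    also have "\<dots> = f (l - 1) + f (l + 1) + f l" by (simp only: x_def l)
    finally have sum: "(\<Sum>j\<in>ladder_nbrs i. x j) = f (l - 1) + f (l + 1) + f l" .
    have xi: "x i = f l" by (simp add: x_def l_def)
    have "(1 + 2 * cos \<phi>) * f l \<le> f (l - 1) + f (l + 1) + f l"
    proof (cases "l < q")
      case True
      then show ?thesis using f_rec[of l] l(1) by (simp add: algebra_simps)
    next
      case False
      then show ?thesis using f_nonneg[of "l - 1"] f_zero[of l] f_zero[of "l + 1"]
        by simp
    qed
    then show ?thesis unfolding sum xi .
  qed
  have nbr_sum: "(\<Sum>j<n. of_bool ((i, j) \<in> ?E) * x j) = (\<Sum>j\<in>ladder_nbrs i. x j)" if "i < n" for i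
  proof -
    have "(\<Sum>j<n. of_bool ((i, j) \<in> ?E) * x j) = (\<Sum>j\<in>{..<n} \<inter> {j. (i, j) \<in> ?E}. x j)" by simp
    also have "\<dots> = (\<Sum>j\<in>ladder_nbrs i. x j)"
    proof (intro sum.mono_neutral_left finite_ladder_nbrs)
      show "\<forall>j\<in>ladder_nbrs i - {..<n} \<inter> {j. (i, j) \<in> ?E}. x j = 0"
        using that by (auto simp: parcs_capped_ladder x_def q_def intro!: f_zero div_le_mono)
    qed (auto simp: parcs_capped_ladder)
    finally show ?thesis .
  qed
  have "(1 + 2 * cos \<phi>) * (\<Sum>i<n. (x i)\<^sup>2) = (\<Sum>i<n. x i * ((1 + 2 * cos \<phi>) * x i))"
    unfolding sum_distrib_left by (intro sum.cong refl) (simp add: power2_eq_square)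
  also have "\<dots> \<le> (\<Sum>i<n. x i * (\<Sum>j<n. of_bool ((i, j) \<in> ?E) * x j))"
  proof (intro sum_mono mult_left_mono)
    fix i assume "i \<in> {..<n}"
    then have "i < n" by simp
    then show "(1 + 2 * cos \<phi>) * x i \<le> (\<Sum>j<n. of_bool ((i, j) \<in> ?E) * x j)"
      unfolding nbr_sum[OF \<open>i < n\<close>] by (rule local)
    show "0 \<le> x i" using f_nonneg by (simp add: x_def)
  qed
  also have "\<dots> = (\<Sum>i<n. \<Sum>j<n. of_bool ((i, j) \<in> ?E) * x i * x j)"
    unfolding sum_distrib_left by (intro sum.cong refl) simp
  also have "\<dots> \<le> graph_spectral_radius n (capped_ladder n) * (\<Sum>i<n. (x i)\<^sup>2)"
    by (rule rayleigh_le_graph_spectral_radius) (use n in simp, rule parcs_capped_ladder_sym)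
  finally have le: "(1 + 2 * cos \<phi>) * (\<Sum>i<n. (x i)\<^sup>2)
      \<le> graph_spectral_radius n (capped_ladder n) * (\<Sum>i<n. (x i)\<^sup>2)" .
  have "(\<Sum>i<n. (x i)\<^sup>2) > 0"
    using n f_cap(1) by (intro sum_pos2[of _ 0]) (auto simp: x_def)
  with le show ?thesis by (simp add: \<phi>_def q_def mult_le_cancel_right)
qed

lemma finite_connected_irregular_bipartite_graphs:
  "finite (connected_irregular_bipartite_graphs n \<Delta>)"
proof (rule finite_subset)
  let ?mk = "\<lambda>A. \<lparr>pverts = {..<n}, parcs = A\<rparr>"
  show "connected_irregular_bipartite_graphs n \<Delta> \<subseteq> ?mk ` Pow ({..<n} \<times> {..<n})"
  proof
    fix G assume G: "G \<in> connected_irregular_bipartite_graphs n \<Delta>"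
    then interpret pair_graph G by (simp add: connected_irregular_bipartite_graphs_def)
    have V: "pverts G = {..<n}" using G by (simp add: connected_irregular_bipartite_graphs_def)
    then have "G = ?mk (parcs G)" by simp
    moreover have "parcs G \<subseteq> {..<n} \<times> {..<n}" using V in_arcsD1 in_arcsD2 by auto
    ultimately show "G \<in> ?mk ` Pow ({..<n} \<times> {..<n})" by blast
  qed
qed auto

lemma max_spectral_radius_bounds:
  assumes n: "n \<ge> 8"
  shows "max_spectral_radius n 3 \<le> 1 + 2 * cos (pi / (real n + 1))"
    and "1 + 2 * cos (pi / (2 * real (n div 2 - 2))) \<le> max_spectral_radius n 3"
proof -
  let ?B = "connected_irregular_bipartite_graphs n 3"
  have fin: "finite (graph_spectral_radius n ` ?B)"
    by (simp add: finite_connected_irregular_bipartite_graphs)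
  show "max_spectral_radius n 3 \<le> 1 + 2 * cos (pi / (real n + 1))"
    unfolding max_spectral_radius_def
    using n capped_ladder_mem[OF n] fin graph_spectral_radius_le by (subst Max_le_iff) auto
  have "graph_spectral_radius n (capped_ladder n) \<le> max_spectral_radius n 3"
    unfolding max_spectral_radius_def using fin capped_ladder_mem[OF n] by (intro Max_ge) auto
  then show "1 + 2 * cos (pi / (2 * real (n div 2 - 2))) \<le> max_spectral_radius n 3"
    using capped_ladder_spectral_radius_ge[OF n] by linarith
qed

lemma two_minus_two_cos_le: "2 - 2 * cos t \<le> t\<^sup>2" for t :: real
proof -
  have "(sin (t / 2))\<^sup>2 \<le> (t / 2)\<^sup>2"
    using abs_sin_x_le_abs_x[of "t / 2"] by (simp only: abs_le_square_iff)
  then show ?thesis using cos_double_sin[of "t / 2"] by (simp add: power_divide)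
qed

theorem theorem1p4:
  shows "(\<lambda>n. (real n)\<^sup>2 * (3 - max_spectral_radius n 3)) \<longlonglongrightarrow> pi\<^sup>2"
proof (rule tendsto_sandwich)
  show "\<forall>\<^sub>F n in sequentially. (real n)\<^sup>2 * (2 - 2 * cos (pi / (real n + 1)))
      \<le> (real n)\<^sup>2 * (3 - max_spectral_radius n 3)"
    using eventually_ge_at_top[of 8]
  proof eventually_elim
    case (elim n)
    then show ?case using max_spectral_radius_bounds(1)[of n] by (intro mult_left_mono) auto
  qed
  show "\<forall>\<^sub>F n in sequentially. (real n)\<^sup>2 * (3 - max_spectral_radius n 3)
      \<le> (real n)\<^sup>2 * (pi / (real n - 5))\<^sup>2"
    using eventually_ge_at_top[of 8]
  proof eventually_elim
    case (elim n)
    let ?t = "pi / (2 * real (n div 2 - 2))"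
    have "3 - max_spectral_radius n 3 \<le> 2 - 2 * cos ?t"
      using max_spectral_radius_bounds(2)[OF elim] by simp
    also have "\<dots> \<le> ?t\<^sup>2" by (rule two_minus_two_cos_le)
    also have "\<dots> \<le> (pi / (real n - 5))\<^sup>2"
    proof (intro power_mono divide_left_mono)
      show "real n - 5 \<le> 2 * real (n div 2 - 2)" using elim by linarith
    qed (use elim in auto)
    finally show ?case by (intro mult_left_mono) auto
  qed
  show "(\<lambda>n. (real n)\<^sup>2 * (2 - 2 * cos (pi / (real n + 1)))) \<longlonglongrightarrow> pi\<^sup>2"
    unfolding power2_eq_square[of pi] by real_asymp
  show "(\<lambda>n. (real n)\<^sup>2 * (pi / (real n - 5))\<^sup>2) \<longlonglongrightarrow> pi\<^sup>2"
    by real_asymp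
qed

end
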